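(* Let $(X,E(X))$ be an infinite, connected, locally finite, non-oriented graph, $o\in X$ a fixed vertex, and $(X,P)$ a random walk on $X$. Let $\infty$ be the point added to the discrete space $X$ to form its one-point compactification. (i) If there exists $A\subseteq X$ measurable such that $L_o(A)=1$ and $\lim_{x\to\infty,\,x\in A}F(x,x)=\alpha$, then $L_o(F)$ exists and equals $\alpha$; thus the random walk is TOA (respectively ROA) if and only if $\alpha<1$ (respectively $\alpha=1$). (ii) If $(X,P)$ is (locally) recurrent then $L_o(F)$ exists, equals $1$, and the random walk is ROA. (iii) If $(X,P)$ is thermodynamically recurrent on the average with respect to $o$ then $L_o(F)$ exists, equals $1$, and the random walk is ROA. (iv) If the series $F(x,x)=\sum_{n\ge1} f^{(n)}(x,x)$ is totally convergent with respect to $x\in X$ and $(X,P)$ is thermodynamically transient on the average with respect to $o$, then $L_o(F)$ exists, it is less than $1$, and the random walk is TOA. (v) $(X,P)$ is ROA if and only if for every $\varepsilon>0$ the set $\{x: F(x,x)\ge 1-\varepsilon\}$ is measurable with measure $1$. (vi) $(X,P)$ is ROA if and only if there exists $A\subseteq X$ measurable such that $L_o(A)=1$ and $\lim_{x\to\infty,\,x\in A}F(x,x)=1$. (vii) $(X,P)$ is TOA if and only if there exists $A\subseteq X$ such that $\mathrm{sup}L_o(A)>0$ and $\sup_{x\in A}F(x,x)<1$.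
   Context: A random walk $(X,P)$ is a Markov chain on $X$ with stochastic transition matrix $P$, not assumed to be adapted to the graph. $f^{(n)}(x,x)$, $n\ge1$, is the probability that the walk started at $x$ returns to $x$ for the first time at time $n$; $F(x,x|z)=\sum_{n\ge1}f^{(n)}(x,x)z^n$ and $F(x,x)=F(x,x|1)$. An irreducible random walk is (locally) recurrent if $F(x,x)=1$ for some (equivalently every) $x$. The series $F(x,x)$ is totally convergent with respect to $x\in X$ if $\sum_{n\ge1}\sup_{x\in X}f^{(n)}(x,x)<+\infty$. Averages over balls: for $g:X\to\mathbb R$ put $A_n(g)=\frac1{|B(o,n)|}\sum_{x\in B(o,n)}g(x)$, with $B(o,n)$ the closed ball of centre $o$ and radius $n$. $L_o(g)=\lim_n A_n(g)$ when this limit exists (and is finite), $\mathrm{inf}L_o(g)=\liminf_n A_n(g)$, $\mathrm{sup}L_o(g)=\limsup_nA_n(g)$. A set $A\subseteq X$ is measurable if $L_o(\chi_A)$ exists; one writes $L_o(A)=L_o(\chi_A)$ (the measure of $A$) and $\mathrm{sup}L_o(A)=\mathrm{sup}L_o(\chi_A)$. $L_o(F)$ denotes $L_o$ applied to $x\mapsto F(x,x)$ and $L_o(F(z))$ denotes $L_o$ applied to $x\mapsto F(x,x|z)$. $(X,P)$ is TOA (transient on the average) if $\mathrm{inf}L_o(F)<1$ and ROA (recurrent on the average) if $\mathrm{inf}L_o(F)=1$. Suppose $L_o(F(z))$ exists for all $z\in(\varepsilon,1)$, for some $\varepsilon\in(0,1)$; then $(X,P)$ is thermodynamically transient on the average with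 respect to $o$ if $\lim_{z\to1^-}L_o(F(z))<1$ and thermodynamically recurrent on the average with respect to $o$ if this limit equals $1$. *)

theory Defs
  imports "HOL-Probability.Probability"
begin

section \<open>Graphs\<close>

text \<open>
  A non-oriented graph with vertex set \<open>X\<close> is given by a symmetric edge relation \<open>E\<close> on \<open>X\<close>.
  Loops are neither required nor excluded; they do not influence distances.
\<close>

definition nonoriented_graph :: "'a set \<Rightarrow> ('a \<times> 'a) set \<Rightarrow> bool" where
  "nonoriented_graph X E \<longleftrightarrow> E \<subseteq> X \<times> X \<and> sym E"

definition graph_connected :: "'a set \<Rightarrow> ('a \<times> 'a) set \<Rightarrow> bool" where
  "graph_connected X E \<longleftrightarrow> (\<forall>x\<in>X. \<forall>y\<in>X. (x, y) \<in> E\<^sup>*)"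

definition locally_finite_graph :: "'a set \<Rightarrow> ('a \<times> 'a) set \<Rightarrow> bool" where
  "locally_finite_graph X E \<longleftrightarrow> (\<forall>x\<in>X. finite (E `` {x}))"

text \<open>Only meaningful for vertices joined by a path.\<close>
definition graph_dist :: "('a \<times> 'a) set \<Rightarrow> 'a \<Rightarrow> 'a \<Rightarrow> nat" where
  "graph_dist E x y = (LEAST n. (x, y) \<in> E ^^ n)"

definition graph_ball :: "'a set \<Rightarrow> ('a \<times> 'a) set \<Rightarrow> 'a \<Rightarrow> nat \<Rightarrow> 'a set" where
  "graph_ball X E r n = {x \<in> X. graph_dist E r x \<le> n}"


section \<open>Random walks\<close>

text \<open>
  The row \<open>p(x, \<cdot>)\<close> of the stochastic transition matrix is the probability mass function \<open>P x\<close>,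
  that is \<open>p(x, y) = pmf (P x) y\<close>. No relation with the edges of the graph is required.
\<close>
definition random_walk_on :: "'a set \<Rightarrow> ('a \<Rightarrow> 'a pmf) \<Rightarrow> bool" where
  "random_walk_on X P \<longleftrightarrow> (\<forall>x\<in>X. set_pmf (P x) \<subseteq> X)"

text \<open>The joint law of the first \<open>n + 1\<close> positions \<open>[Z\<^sub>0, \<dots>, Z\<^sub>n]\<close> of the chain started at \<open>x\<close>.\<close>
primrec trajectory :: "('a \<Rightarrow> 'a pmf) \<Rightarrow> nat \<Rightarrow> 'a \<Rightarrow> 'a list pmf" where
  "trajectory P 0 x = return_pmf [x]"
| "trajectory P (Suc n) x = bind_pmf (P x) (\<lambda>y. map_pmf ((#) x) (trajectory P n y))"

definition n_step :: "('a \<Rightarrow> 'a pmf) \<Rightarrow> nat \<Rightarrow> 'a \<Rightarrow> 'a \<Rightarrow> real" where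
  "n_step P n x y = measure_pmf.prob (trajectory P n x) {w. w ! n = y}"

text \<open>\<open>f\<^sup>(\<^sup>n\<^sup>)(x, x)\<close>; used for \<open>n \<ge> 1\<close> only.\<close>
definition first_return :: "('a \<Rightarrow> 'a pmf) \<Rightarrow> nat \<Rightarrow> 'a \<Rightarrow> real" where
  "first_return P n x =
     measure_pmf.prob (trajectory P n x) {w. w ! n = x \<and> (\<forall>k\<in>{1..<n}. w ! k \<noteq> x)}"

text \<open>\<open>F(x, x | z)\<close> for real \<open>z\<close>.\<close>
definition return_gf :: "('a \<Rightarrow> 'a pmf) \<Rightarrow> real \<Rightarrow> 'a \<Rightarrow> real" where
  "return_gf P z x = (\<Sum>n. first_return P (Suc n) x * z ^ Suc n)"

text \<open>\<open>F(x, x)\<close>\<close>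
definition return_prob :: "('a \<Rightarrow> 'a pmf) \<Rightarrow> 'a \<Rightarrow> real" where
  "return_prob P x = return_gf P 1 x"

definition irreducible_walk :: "'a set \<Rightarrow> ('a \<Rightarrow> 'a pmf) \<Rightarrow> bool" where
  "irreducible_walk X P \<longleftrightarrow> (\<forall>x\<in>X. \<forall>y\<in>X. \<exists>n. n_step P n x y > 0)"

definition locally_recurrent :: "'a set \<Rightarrow> ('a \<Rightarrow> 'a pmf) \<Rightarrow> bool" where
  "locally_recurrent X P \<longleftrightarrow> irreducible_walk X P \<and> (\<exists>x\<in>X. return_prob P x = 1)"

definition totally_convergent :: "'a set \<Rightarrow> ('a \<Rightarrow> 'a pmf) \<Rightarrow> bool" where
  "totally_convergent X P \<longleftrightarrow> summable (\<lambda>n. SUP x\<in>X. first_return P (Suc n) x)"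


section \<open>Averages over balls\<close>

definition ball_avg :: "'a set \<Rightarrow> ('a \<times> 'a) set \<Rightarrow> 'a \<Rightarrow> ('a \<Rightarrow> real) \<Rightarrow> nat \<Rightarrow> real" where
  "ball_avg X E r g n = (\<Sum>x\<in>graph_ball X E r n. g x) / real (card (graph_ball X E r n))"

definition L_exists :: "'a set \<Rightarrow> ('a \<times> 'a) set \<Rightarrow> 'a \<Rightarrow> ('a \<Rightarrow> real) \<Rightarrow> bool" where
  "L_exists X E r g \<longleftrightarrow> convergent (ball_avg X E r g)"

text \<open>Only meaningful under \<^const>\<open>L_exists\<close>.\<close>
definition L_avg :: "'a set \<Rightarrow> ('a \<times> 'a) set \<Rightarrow> 'a \<Rightarrow> ('a \<Rightarrow> real) \<Rightarrow> real" where
  "L_avg X E r g = lim (ball_avg X E r g)"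

definition infL :: "'a set \<Rightarrow> ('a \<times> 'a) set \<Rightarrow> 'a \<Rightarrow> ('a \<Rightarrow> real) \<Rightarrow> ereal" where
  "infL X E r g = liminf (\<lambda>n. ereal (ball_avg X E r g n))"

definition supL :: "'a set \<Rightarrow> ('a \<times> 'a) set \<Rightarrow> 'a \<Rightarrow> ('a \<Rightarrow> real) \<Rightarrow> ereal" where
  "supL X E r g = limsup (\<lambda>n. ereal (ball_avg X E r g n))"

definition L_measurable :: "'a set \<Rightarrow> ('a \<times> 'a) set \<Rightarrow> 'a \<Rightarrow> 'a set \<Rightarrow> bool" where
  "L_measurable X E r A \<longleftrightarrow> A \<subseteq> X \<and> L_exists X E r (indicator A)"

definition L_set :: "'a set \<Rightarrow> ('a \<times> 'a) set \<Rightarrow> 'a \<Rightarrow> 'a set \<Rightarrow> real" where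
  "L_set X E r A = L_avg X E r (indicator A)"

definition supL_set :: "'a set \<Rightarrow> ('a \<times> 'a) set \<Rightarrow> 'a \<Rightarrow> 'a set \<Rightarrow> ereal" where
  "supL_set X E r A = supL X E r (indicator A)"

text \<open>
  The filter of \<open>x \<rightarrow> \<infinity>\<close> with \<open>x \<in> A\<close>, taken in the one-point compactification of the discrete
  space \<open>X\<close>, whose underlying set is \<open>Some ` X\<close> together with the point at infinity \<^const>\<open>None\<close>.
\<close>
definition to_infinity_in :: "'a set \<Rightarrow> 'a set \<Rightarrow> 'a filter" where
  "to_infinity_in X A =
     filtermap the (atin_within (Alexandroff_compactification (discrete_topology X)) None (Some ` A))"


section \<open>Classification on the average\<close>

definition TOA :: "'a set \<Rightarrow> ('a \<times> 'a) set \<Rightarrow> 'a \<Rightarrow> ('a \<Rightarrow> 'a pmf) \<Rightarrow> bool" where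
  "TOA X E r P \<longleftrightarrow> infL X E r (return_prob P) < 1"

definition ROA :: "'a set \<Rightarrow> ('a \<times> 'a) set \<Rightarrow> 'a \<Rightarrow> ('a \<Rightarrow> 'a pmf) \<Rightarrow> bool" where
  "ROA X E r P \<longleftrightarrow> infL X E r (return_prob P) = 1"

definition L_exists_near_1 :: "'a set \<Rightarrow> ('a \<times> 'a) set \<Rightarrow> 'a \<Rightarrow> ('a \<Rightarrow> 'a pmf) \<Rightarrow> bool" where
  "L_exists_near_1 X E r P \<longleftrightarrow>
     (\<exists>\<epsilon>\<in>{0<..<1}. \<forall>z\<in>{\<epsilon><..<1}. L_exists X E r (return_gf P z))"

definition thermo_TOA :: "'a set \<Rightarrow> ('a \<times> 'a) set \<Rightarrow> 'a \<Rightarrow> ('a \<Rightarrow> 'a pmf) \<Rightarrow> bool" where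
  "thermo_TOA X E r P \<longleftrightarrow> L_exists_near_1 X E r P \<and>
     (\<exists>l<1. ((\<lambda>z. L_avg X E r (return_gf P z)) \<longlongrightarrow> l) (at_left 1))"

definition thermo_ROA :: "'a set \<Rightarrow> ('a \<times> 'a) set \<Rightarrow> 'a \<Rightarrow> ('a \<Rightarrow> 'a pmf) \<Rightarrow> bool" where
  "thermo_ROA X E r P \<longleftrightarrow> L_exists_near_1 X E r P \<and>
     ((\<lambda>z. L_avg X E r (return_gf P z)) \<longlongrightarrow> 1) (at_left 1)"

end

theory Submission
  imports Defs
begin

text \<open>
  Since \<open>0 \<le> F(x, x) \<le> 1\<close>, being ROA means that the ball averages of \<open>F\<close> converge to \<open>1\<close>, and TOA
  is its negation. By Markov's inequality, averages of a bounded nonnegative function tend to \<open>0\<close> iff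
  all its superlevel sets have density \<open>0\<close>; this yields (i), (v) and (vii). For (vi), the superlevel
  sets are cut off at a threshold that decreases to \<open>0\<close> slowly with the distance from the root.
  For (ii), the renewal equation shows that \<open>F(x, x) < 1\<close> iff the Green function is finite, and
  finiteness of the Green function does not depend on the vertex of an irreducible walk.
  In (iii) the averages are squeezed by \<open>F(x, x | z) \<le> F(x, x) \<le> 1\<close>; in (iv) total convergence
  makes \<open>F(x, x | z) \<rightarrow> F(x, x)\<close> uniform in \<open>x\<close>, so the two limits may be interchanged.
\<close>

section \<open>Recurrence\<close>

text \<open>First-step analysis moves the starting point away from the target, so the recursions
  close only when the two may differ. As with \<open>first_return\<close>, only times
  \<open>Suc n\<close> are of interest.\<close>

definition first_passage :: "('a \<Rightarrow> 'a pmf) \<Rightarrow> nat \<Rightarrow> 'a \<Rightarrow> 'a \<Rightarrow> real" where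
  "first_passage P n x y =
     measure_pmf.prob (trajectory P n x) {w. w ! n = y \<and> (\<forall>k\<in>{1..<n}. w ! k \<noteq> y)}"

lemma first_return_eq: "first_return P n x = first_passage P n x x"
  by (simp add: first_return_def first_passage_def)

lemma first_passage_nonneg: "0 \<le> first_passage P n x y"
  by (simp add: first_passage_def)

lemma first_passage_le_1: "first_passage P n x y \<le> 1"
  by (simp add: first_passage_def)

lemma n_step_nonneg: "0 \<le> n_step P n x y"
  by (simp add: n_step_def)

lemma n_step_le_1: "n_step P n x y \<le> 1"
  by (simp add: n_step_def)

section \<open>First-step analysis and the renewal equation\<close>

lemma integrable_pmf_bounded:
  fixes g :: "'a \<Rightarrow> real"
  assumes "\<And>x. \<bar>g x\<bar> \<le> C"
  shows "integrable (measure_pmf M) g"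
  using assms by (intro measure_pmf.integrable_const_bound[where B = C]) auto

lemma integrable_n_step: "integrable (measure_pmf M) (\<lambda>z. n_step P n z y)"
  by (rule integrable_pmf_bounded[where C = 1]) (simp add: n_step_nonneg n_step_le_1)

lemma prob_bind_pmf:
  "measure_pmf.prob (bind_pmf M f) A = (\<integral>x. measure_pmf.prob (f x) A \<partial>measure_pmf M)"
proof -
  have "integrable (measure_pmf M) (\<lambda>x. measure_pmf.prob (f x) A)"
    by (rule integrable_pmf_bounded[where C = 1]) simp
  then have "ennreal (measure_pmf.prob (bind_pmf M f) A) =
      ennreal (\<integral>x. measure_pmf.prob (f x) A \<partial>measure_pmf M)"
    by (simp add: measure_pmf.emeasure_eq_measure[symmetric] nn_integral_eq_integral[symmetric])
  then show ?thesis
    by (subst (asm) ennreal_inj) (auto intro: integral_nonneg)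
qed

lemma trajectory_start: "w \<in> set_pmf (trajectory P n x) \<Longrightarrow> w ! 0 = x"
  by (cases n) auto

lemma n_step_0: "n_step P 0 x y = (if x = y then 1 else 0)"
  by (simp add: n_step_def)

lemma n_step_Suc: "n_step P (Suc n) x y = (\<integral>z. n_step P n z y \<partial>P x)"
  by (simp add: n_step_def prob_bind_pmf vimage_def)

lemma first_passage_1: "first_passage P (Suc 0) x y = (\<integral>z. indicator {y} z \<partial>P x)"
  by (simp add: first_passage_def prob_bind_pmf vimage_def indicator_def)

text \<open>Deleting the initial state x shifts all times by one. Avoiding y at time 1 becomes a
  condition on the start z of the remaining path, which lies outside the range
  \<open>{1..<Suc n}\<close> seen by \<open>first_passage\<close>; hence the separate case
  \<open>z = y\<close>.\<close>

lemma first_passage_Suc_Suc: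
  "first_passage P (Suc (Suc n)) x y =
    (\<integral>z. (if z = y then 0 else first_passage P (Suc n) z y) \<partial>P x)"
proof -
  let ?B = "{w. w ! Suc n = y \<and> (\<forall>k\<in>{1..<Suc (Suc n)}. (x # w) ! k \<noteq> y)}"
  have B: "?B = {w. w ! 0 \<noteq> y \<and> w ! Suc n = y \<and> (\<forall>k\<in>{1..<Suc n}. w ! k \<noteq> y)}"
  proof -
    have "(\<forall>k\<in>{1..<Suc (Suc n)}. (x # w) ! k \<noteq> y) \<longleftrightarrow>
        w ! 0 \<noteq> y \<and> (\<forall>k\<in>{1..<Suc n}. w ! k \<noteq> y)" for w
    proof -
      have "(\<forall>k\<in>{1..<Suc (Suc n)}. (x # w) ! k \<noteq> y) \<longleftrightarrow> (\<forall>k\<in>{0..<Suc n}. w ! k \<noteq> y)"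
        unfolding One_nat_def image_Suc_atLeastLessThan[symmetric]
        by (metis (no_types, lifting) imageE imageI nth_Cons_Suc)
      also have "{0..<Suc n} = insert 0 {1..<Suc n}"
        by auto
      finally show ?thesis by simp
    qed
    then show ?thesis by blast
  qed
  \<comment> \<open>Almost surely the remaining path starts in z, so the condition at index 0 is
    decided by z alone.\<close>
  have "measure_pmf.prob (trajectory P (Suc n) z) ?B =
      (if z = y then 0 else first_passage P (Suc n) z y)" for z
    unfolding B first_passage_def
    by (auto intro!: measure_prob_cong_0 simp del: trajectory.simps dest: trajectory_start
        simp: set_pmf_iff[symmetric] measure_pmf_zero_iff)
  then show ?thesis
    by (subst first_passage_def)
      (simp add: prob_bind_pmf vimage_def del: trajectory.simps(2) add: trajectory.simps(2)[of P "Suc n" x])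
qed

text \<open>First visits to y at different times exclude each other. The induction expresses this by
  conditioning on the first step z: for \<open>z = y\<close> only the term of time 1 survives, for
  \<open>z \<noteq> y\<close> only the later ones do, and these sum to at most 1 by the hypothesis
  for the start z.\<close>

lemma sum_first_passage_le_1: "(\<Sum>k<n. first_passage P (Suc k) x y) \<le> 1"
proof (induction n arbitrary: x)
  case 0
  then show ?case by simp
next
  case (Suc n)
  let ?g = "\<lambda>k z. if z = y then 0 else first_passage P (Suc k) z y"
  have int: "integrable (measure_pmf M) (?g k)" for M k
    by (rule integrable_pmf_bounded[where C = 1])
      (simp add: first_passage_nonneg first_passage_le_1)
  have int_ind: "integrable (measure_pmf M) (indicator {y} :: 'a \<Rightarrow> real)" for M
    by (rule integrable_pmf_bounded[where C = 1]) simp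
  have "(\<Sum>k<Suc n. first_passage P (Suc k) x y) =
      (\<integral>z. indicator {y} z \<partial>P x) + (\<Sum>k<n. \<integral>z. ?g k z \<partial>P x)"
    by (simp only: sum.lessThan_Suc_shift first_passage_1 first_passage_Suc_Suc)
  also have "\<dots> = (\<integral>z. indicator {y} z + (\<Sum>k<n. ?g k z) \<partial>P x)"
    by (subst Bochner_Integration.integral_add)
      (simp_all only: Bochner_Integration.integrable_sum int int_ind Bochner_Integration.integral_sum)
  also have "\<dots> \<le> (\<integral>z. 1 \<partial>P x)"
    using Suc.IH
    by (intro integral_mono Bochner_Integration.integrable_add Bochner_Integration.integrable_sum
        int int_ind) (auto simp: indicator_def)
  finally show ?case by simp
qed

text \<open>Paths are decomposed at their first visit to y, at time \<open>Suc k\<close>. First-step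
  analysis inside an induction with arbitrary start plays the role of the strong Markov
  property.\<close>

lemma n_step_renewal:
  "n_step P (Suc n) x y = (\<Sum>k\<le>n. first_passage P (Suc k) x y * n_step P (n - k) y y)"
proof (induction n arbitrary: x)
  case 0
  show ?case
    by (auto simp: n_step_Suc n_step_0 first_passage_1 indicator_def intro!: Bochner_Integration.integral_cong)
next
  case (Suc n)
  let ?g = "\<lambda>k z. if z = y then 0 else first_passage P (Suc k) z y"
  have int: "integrable (measure_pmf M) (?g k)" for M k
    by (rule integrable_pmf_bounded[where C = 1])
      (simp add: first_passage_nonneg first_passage_le_1)
  have "n_step P (Suc (Suc n)) x y = (\<integral>z. n_step P (Suc n) z y \<partial>P x)"
    by (rule n_step_Suc)
  \<comment> \<open>For \<open>z = y\<close> the first visit happens at time 1 and the walk restarts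
    from y; for \<open>z \<noteq> y\<close> the induction hypothesis applies to z. After integration
    the two summands become the term k = 0 and the shifted remaining terms.\<close>
  also have "\<dots> = (\<integral>z. indicator {y} z * n_step P (Suc n) y y +
      (\<Sum>k\<le>n. ?g k z * n_step P (n - k) y y) \<partial>P x)"
    by (intro Bochner_Integration.integral_cong refl) (auto simp: Suc.IH indicator_def simp del: sum.atMost_Suc)
  also have "\<dots> = (\<integral>z. indicator {y} z \<partial>P x) * n_step P (Suc n) y y +
      (\<Sum>k\<le>n. (\<integral>z. ?g k z \<partial>P x) * n_step P (n - k) y y)"
    by (subst Bochner_Integration.integral_add)
      (auto intro!: Bochner_Integration.integrable_sum int integrable_mult_left
        integrable_pmf_bounded[where C = 1] simp: Bochner_Integration.integral_sum int)
  also have "\<dots> = (\<Sum>k\<le>Suc n. first_passage P (Suc k) x y * n_step P (Suc n - k) y y)"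
    by (simp only: sum.atMost_Suc_shift first_passage_1 first_passage_Suc_Suc diff_Suc_Suc diff_zero)
  finally show ?case .
qed

text \<open>Half of Chapman-Kolmogorov: only the paths that pass through y at time m are
  kept.\<close>

lemma n_step_mult_le: "n_step P m x y * n_step P n y z \<le> n_step P (m + n) x z"
proof (induction m arbitrary: x)
  case 0
  then show ?case by (simp add: n_step_0 n_step_nonneg)
next
  case (Suc m)
  have "n_step P (Suc m) x y * n_step P n y z = (\<integral>w. n_step P m w y * n_step P n y z \<partial>P x)"
    by (simp add: n_step_Suc)
  also have "\<dots> \<le> (\<integral>w. n_step P (m + n) w z \<partial>P x)"
    by (intro integral_mono integrable_n_step integrable_mult_left Suc.IH)
  finally show ?case by (simp add: n_step_Suc)
qed

text \<open>Summing the renewal equation gives U = 1 + F U for the totals U of u and F of f. A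
  finite U excludes F = 1; conversely the partial sums satisfy U_N \<le> 1 + F U_N, which bounds
  them when F < 1.\<close>

lemma renewal_summable_iff:
  fixes f u :: "nat \<Rightarrow> real"
  assumes f: "\<And>n. 0 \<le> f n" "summable f" "suminf f \<le> 1"
    and u: "\<And>n. 0 \<le> u n" "u 0 = 1"
    and renewal: "\<And>n. u (Suc n) = (\<Sum>k\<le>n. f k * u (n - k))"
  shows "summable u \<longleftrightarrow> suminf f < 1"
proof
  assume "summable u"
  then have "(\<lambda>n. u (Suc n)) sums (suminf f * suminf u)"
    unfolding renewal using f u by (intro Cauchy_product_sums) auto
  from sums_unique[OF sums_Suc[OF this]] have "suminf u = suminf f * suminf u + 1"
    using u(2) by simp
  then have "suminf f \<noteq> 1"
    by auto
  then show "suminf f < 1"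
    using f(3) by simp
next
  assume less: "suminf f < 1"
  let ?U = "\<lambda>N. \<Sum>n<N. u n"
  have "?U N \<le> 1 / (1 - suminf f)" for N
  proof -
    have "?U N \<le> ?U (Suc N)"
      using u(1) by simp
    also have "\<dots> = 1 + (\<Sum>n<N. \<Sum>k\<le>n. f k * u (n - k))"
      by (simp only: sum.lessThan_Suc_shift u(2) renewal)
    also have "(\<Sum>n<N. \<Sum>k\<le>n. f k * u (n - k)) = (\<Sum>(i,j)\<in>{(i,j). i + j < N}. f i * u j)"
      by (rule sum.triangle_reindex[symmetric])
    \<comment> \<open>Enlarging the triangle to a square makes the double sum factor.\<close>
    also have "\<dots> \<le> (\<Sum>(i,j)\<in>{..<N} \<times> {..<N}. f i * u j)"
      using f(1) u(1) by (intro sum_mono2) auto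
    also have "\<dots> = (\<Sum>i<N. f i) * ?U N"
      by (simp add: sum_product sum.cartesian_product)
    also have "\<dots> \<le> suminf f * ?U N"
      using f u by (intro mult_right_mono sum_le_suminf sum_nonneg) auto
    finally show ?thesis
      using less by (simp add: field_simps)
  qed
  then show "summable u"
    using u(1) by (intro summableI_nonneg_bounded) auto
qed

section \<open>Return probabilities and their generating functions\<close>

lemma first_return_nonneg: "0 \<le> first_return P n x"
  by (simp add: first_return_def)

lemma first_return_le_1: "first_return P n x \<le> 1"
  by (simp add: first_return_def)

lemma summable_first_return: "summable (\<lambda>n. first_return P (Suc n) x)"
  by (rule summableI_nonneg_bounded[where x = 1])
    (simp_all add: first_return_eq first_passage_nonneg sum_first_passage_le_1)

lemma return_prob_eq: "return_prob P x = (\<Sum>n. first_return P (Suc n) x)"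
  by (simp add: return_prob_def return_gf_def)

lemma return_prob_nonneg: "0 \<le> return_prob P x"
  unfolding return_prob_eq by (rule suminf_nonneg[OF summable_first_return]) (rule first_return_nonneg)

lemma return_prob_le_1: "return_prob P x \<le> 1"
  unfolding return_prob_eq
  by (rule suminf_le_const[OF summable_first_return]) (simp add: first_return_eq sum_first_passage_le_1)

text \<open>The renewal equation on the diagonal turns finiteness of the Green function at x into
  transience at x.\<close>

lemma summable_n_step_iff: "summable (\<lambda>n. n_step P n x x) \<longleftrightarrow> return_prob P x < 1"
  unfolding return_prob_eq
proof (rule renewal_summable_iff)
  show "n_step P (Suc n) x x = (\<Sum>k\<le>n. first_return P (Suc k) x * n_step P (n - k) x x)" for n
    by (simp add: first_return_eq n_step_renewal)
qed (use return_prob_le_1[of P x] in \<open>auto simp: return_prob_eq first_return_nonneg summable_first_return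
      n_step_nonneg n_step_0\<close>)

text \<open>Recurrence is given at a single vertex x. Paths that go from y to x in m steps, loop at
  x for k steps and go back in n steps show that a finite Green function at y would force a finite
  one at x.\<close>

lemma locally_recurrent_return_prob:
  assumes "locally_recurrent X P" "y \<in> X"
  shows "return_prob P y = 1"
proof (rule ccontr)
  assume "return_prob P y \<noteq> 1"
  then have summable: "summable (\<lambda>n. n_step P n y y)"
    using return_prob_le_1[of P y] by (simp add: summable_n_step_iff)
  obtain x where x: "x \<in> X" "return_prob P x = 1" and irr: "irreducible_walk X P"
    using assms(1) by (auto simp: locally_recurrent_def)
  obtain m n where mn: "n_step P m y x > 0" "n_step P n x y > 0"
    using irr x(1) assms(2) unfolding irreducible_walk_def by meson
  have "summable (\<lambda>k. n_step P ((m + n) + k) y y)"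
    using summable by (subst add.commute) (rule summable_ignore_initial_segment)
  moreover have "n_step P m y x * n_step P n x y * n_step P k x x \<le> n_step P ((m + n) + k) y y" for k
  proof -
    have "n_step P m y x * (n_step P k x x * n_step P n x y) \<le> n_step P m y x * n_step P (k + n) x y"
      by (intro mult_left_mono n_step_mult_le n_step_nonneg)
    also have "\<dots> \<le> n_step P (m + (k + n)) y y"
      by (rule n_step_mult_le)
    finally show ?thesis by (simp add: ac_simps)
  qed
  ultimately have "summable (\<lambda>k. n_step P m y x * n_step P n x y * n_step P k x x)"
    by (rule_tac summable_comparison_test') (auto simp: n_step_nonneg)
  then have "summable (\<lambda>k. n_step P k x x)"
    using mn by (simp add: summable_cmult_iff)
  then show False
    using x(2) by (simp add: summable_n_step_iff)
qed

lemma return_gf_le_return_prob: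
  assumes "0 \<le> z" "z \<le> 1"
  shows "return_gf P z x \<le> return_prob P x"
proof -
  have le: "first_return P (Suc n) x * z ^ Suc n \<le> first_return P (Suc n) x" for n
    using assms by (intro mult_left_le power_le_one first_return_nonneg)
  have "summable (\<lambda>n. first_return P (Suc n) x * z ^ Suc n)"
    using assms le
    by (intro summable_comparison_test'[OF summable_first_return[of P x]])
      (auto simp: first_return_nonneg abs_mult)
  then show ?thesis
    unfolding return_gf_def return_prob_eq
    by (rule suminf_le[OF le _ summable_first_return])
qed

text \<open>Let S n be the supremum over x of the coefficients and G the power series with
  coefficients S. Since every factor 1 - z^n is nonnegative, F(x,x) - F(x,x|z) \<le> G(1) - G(z).
  The right side is free of x and tends to 0, because the M-test makes G continuous up to 1.\<close>

lemma totally_convergent_uniform: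
  assumes "totally_convergent X P" "e > 0"
  shows "eventually (\<lambda>z. \<forall>x\<in>X. \<bar>return_gf P z x - return_prob P x\<bar> < e) (at_left 1)"
proof -
  define S where "S n = (SUP x\<in>X. first_return P (Suc n) x)" for n
  have S: "summable S"
    using assms(1) by (simp add: totally_convergent_def S_def[abs_def])
  have le_S: "first_return P (Suc n) x \<le> S n" if "x \<in> X" for n x
    unfolding S_def using that
    by (intro cSUP_upper bdd_aboveI[where M = 1]) (auto simp: first_return_le_1)
  show ?thesis
  \<comment> \<open>Nonnegativity of S is read off from some vertex, as the real supremum over the
    empty set has no useful value; for empty X the claim is vacuous.\<close>
  proof (cases "X = {}")
    case False
    then have S_nonneg: "0 \<le> S n" for n
      using le_S first_return_nonneg order_trans by (metis ex_in_conv)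
    have summable_S: "summable (\<lambda>n. S n * z ^ Suc n)" if "0 \<le> z" "z \<le> 1" for z
    proof (rule summable_comparison_test'[OF S])
      show "norm (S n * z ^ Suc n) \<le> S n" for n
        using that S_nonneg by (auto simp: abs_mult intro!: mult_left_le power_le_one simp del: power_Suc)
    qed
    define G where "G z = (\<Sum>n. S n * z ^ Suc n)" for z
    have "continuous_on {0..1} G"
    proof (rule uniform_limit_theorem)
      show "uniform_limit {0..1} (\<lambda>N z. \<Sum>n<N. S n * z ^ Suc n) G sequentially"
        unfolding G_def
      proof (rule Weierstrass_m_test[OF _ S])
        show "norm (S n * z ^ Suc n) \<le> S n" if "z \<in> {0..1}" for n z
          using that S_nonneg by (auto simp: abs_mult intro!: mult_left_le power_le_one simp del: power_Suc)
      qed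
    qed (auto intro!: always_eventually continuous_intros)
    then have "(G \<longlongrightarrow> G 1) (at 1 within {0..1})"
      by (simp add: continuous_on_def)
    then have "(G \<longlongrightarrow> G 1) (at_left 1)"
      by (simp add: at_within_Icc_at_left)
    then have "eventually (\<lambda>z. \<bar>G z - G 1\<bar> < e) (at_left 1)"
      using \<open>e > 0\<close> by (auto simp: tendsto_iff dist_real_def)
    moreover have "eventually (\<lambda>z. z \<in> {0<..<1}) (at_left (1::real))"
      by (rule eventually_at_leftI[of 0]) auto
    ultimately show ?thesis
    proof eventually_elim
      case (elim z)
      then have z: "0 \<le> z" "z \<le> 1" by auto
      have "\<bar>return_gf P z x - return_prob P x\<bar> \<le> \<bar>G z - G 1\<bar>" if "x \<in> X" for x
      proof -
        let ?f = "\<lambda>n. first_return P (Suc n) x"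
        have 1: "summable (\<lambda>n. ?f n * z ^ Suc n)"
        proof (rule summable_comparison_test'[OF summable_S[OF z]])
          show "norm (?f n * z ^ Suc n) \<le> S n * z ^ Suc n" for n
            using that z le_S by (auto simp: abs_mult first_return_nonneg mult_right_mono)
        qed
        have "return_prob P x - return_gf P z x = (\<Sum>n. ?f n - ?f n * z ^ Suc n)"
          unfolding return_prob_eq return_gf_def by (rule suminf_diff[OF summable_first_return 1])
        also have "\<dots> \<le> (\<Sum>n. S n - S n * z ^ Suc n)"
        proof (rule suminf_le)
          show "?f n - ?f n * z ^ Suc n \<le> S n - S n * z ^ Suc n" for n
          proof -
            have "?f n * (1 - z ^ Suc n) \<le> S n * (1 - z ^ Suc n)"
              using z that by (intro mult_right_mono le_S) (auto intro!: power_le_one simp del: power_Suc)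
            then show ?thesis by (simp add: algebra_simps)
          qed
        qed (intro summable_diff summable_first_return S 1 summable_S[OF z])+
        also have "\<dots> = G 1 - G z"
          using suminf_diff[OF S summable_S[OF z]] by (simp add: G_def)
        finally show ?thesis
          using return_gf_le_return_prob[OF z, of P x] by simp
      qed
      then show ?case using elim by force
    qed
  qed simp
qed

section \<open>Averages over balls\<close>

text \<open>Open neighbourhoods of the added point are complements of compact sets, and the compact
  subsets of a discrete space are the finite ones.\<close>

lemma eventually_to_infinity_in:
  assumes "A \<subseteq> X"
  shows "eventually Q (to_infinity_in X A) \<longleftrightarrow> (\<exists>K. finite K \<and> (\<forall>x\<in>A - K. Q x))"
proof -
  have "eventually Q (to_infinity_in X A) \<longleftrightarrow>
      (\<exists>T. openin (Alexandroff_compactification (discrete_topology X)) T \<and> None \<in> T \<and>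
        (\<forall>x\<in>T. x \<in> Some ` A \<and> x \<noteq> None \<longrightarrow> Q (the x)))"
    by (simp add: to_infinity_in_def eventually_filtermap eventually_atin_within)
  also have "\<dots> \<longleftrightarrow> (\<exists>K. finite K \<and> K \<subseteq> X \<and> (\<forall>x\<in>A - K. Q x))"
  proof
    assume "\<exists>T. openin (Alexandroff_compactification (discrete_topology X)) T \<and> None \<in> T \<and>
        (\<forall>x\<in>T. x \<in> Some ` A \<and> x \<noteq> None \<longrightarrow> Q (the x))"
    then show "\<exists>K. finite K \<and> K \<subseteq> X \<and> (\<forall>x\<in>A - K. Q x)"
      using assms by (force simp: openin_Alexandroff_compactification compactin_discrete_topology)
  next
    assume "\<exists>K. finite K \<and> K \<subseteq> X \<and> (\<forall>x\<in>A - K. Q x)"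
    then obtain K where K: "finite K" "K \<subseteq> X" "\<forall>x\<in>A - K. Q x"
      by blast
    then have "openin (Alexandroff_compactification (discrete_topology X))
        (insert None (Some ` (X - K)))"
      by (auto simp: openin_Alexandroff_compactification compactin_discrete_topology
          intro!: exI[of _ K])
    with K show "\<exists>T. openin (Alexandroff_compactification (discrete_topology X)) T \<and> None \<in> T \<and>
        (\<forall>x\<in>T. x \<in> Some ` A \<and> x \<noteq> None \<longrightarrow> Q (the x))"
      by (intro exI[of _ "insert None (Some ` (X - K))"]) auto
  qed
  also have "\<dots> \<longleftrightarrow> (\<exists>K. finite K \<and> (\<forall>x\<in>A - K. Q x))"
  proof
    assume "\<exists>K. finite K \<and> (\<forall>x\<in>A - K. Q x)"
    then obtain K where "finite K" "\<forall>x\<in>A - K. Q x"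
      by blast
    \<comment> \<open>The exceptional set may be cut down to X because
      \<open>A \<subseteq> X\<close>.\<close>
    then show "\<exists>K. finite K \<and> K \<subseteq> X \<and> (\<forall>x\<in>A - K. Q x)"
      using assms by (intro exI[of _ "K \<inter> X"]) auto
  qed blast
  finally show ?thesis .
qed

lemma nonneg_tendsto_0_le:
  fixes f h :: "nat \<Rightarrow> real"
  assumes "h \<longlonglongrightarrow> 0" "\<And>n. 0 \<le> f n" "\<And>n. f n \<le> h n"
  shows "f \<longlonglongrightarrow> 0"
  using assms by (intro tendsto_sandwich[of "\<lambda>_. 0" f sequentially h]) auto

locale ball_averages =
  fixes X :: "'a set" and E :: "('a \<times> 'a) set" and r :: 'a
  assumes nonoriented: "nonoriented_graph X E"
    and infinite_vertices: "infinite X"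
    and connected: "graph_connected X E"
    and locally_finite: "locally_finite_graph X E"
    and root: "r \<in> X"
begin

abbreviation "gball \<equiv> graph_ball X E r"
abbreviation "avg \<equiv> ball_avg X E r"

section \<open>Finiteness and growth of balls\<close>

lemma relpow_graph_dist:
  assumes "x \<in> X"
  shows "(r, x) \<in> E ^^ graph_dist E r x"
proof -
  have "(r, x) \<in> E\<^sup>*"
    using connected root assms by (auto simp: graph_connected_def)
  then show ?thesis
    unfolding graph_dist_def rtrancl_power by (rule LeastI_ex)
qed

lemma finite_Image_relpow: "finite ((E ^^ n) `` {x})"
proof (induction n)
  case (Suc n)
  \<comment> \<open>Vertices outside X have no neighbours because
    \<open>E \<subseteq> X \<times> X\<close>, so neighbourhoods are finite everywhere.\<close>
  have "finite (E `` {y})" for y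
    using nonoriented locally_finite
    by (cases "y \<in> X") (auto simp: nonoriented_graph_def locally_finite_graph_def Image_def
        intro: finite_subset[of _ "{}"])
  moreover have "(E ^^ Suc n) `` {x} = (\<Union>y\<in>(E ^^ n) `` {x}. E `` {y})"
    by auto
  ultimately show ?case using Suc by simp
qed simp

lemma finite_ball: "finite (gball n)"
proof (rule finite_subset)
  show "gball n \<subseteq> (\<Union>k\<le>n. (E ^^ k) `` {r})"
    using relpow_graph_dist by (fastforce simp: graph_ball_def)
qed (simp add: finite_Image_relpow)

lemma ball_subset: "gball n \<subseteq> X"
  by (auto simp: graph_ball_def)

lemma root_in_ball: "r \<in> gball n"
  using root by (auto simp: graph_ball_def graph_dist_def Least_eq_0)

lemma card_ball_pos: "card (gball n) > 0"
  using root_in_ball finite_ball card_gt_0_iff by blast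

lemma card_ball_at_top: "filterlim (\<lambda>n. card (gball n)) at_top sequentially"
  unfolding filterlim_at_top eventually_sequentially
proof
  fix N
  obtain T where T: "finite T" "card T = N" "T \<subseteq> X"
    using infinite_arbitrarily_large[OF infinite_vertices] by blast
  \<comment> \<open>The sum is a crude common bound for the distances of the points of T, and makes
    sense for empty T too.\<close>
  define m where "m = (\<Sum>x\<in>T. graph_dist E r x)"
  have "N \<le> card (gball n)" if "m \<le> n" for n
  proof -
    have "graph_dist E r x \<le> n" if "x \<in> T" for x
      using member_le_sum[of x T "graph_dist E r"] T that \<open>m \<le> n\<close> by (simp add: m_def)
    then have "T \<subseteq> gball n"
      using T by (auto simp: graph_ball_def)
    then show ?thesis
      using T card_mono finite_ball by blast
  qed
  then show "\<exists>m. \<forall>n\<ge>m. N \<le> card (gball n)"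
    by blast
qed

section \<open>Calculus of averages and null sets\<close>

lemma avg_mono:
  assumes "\<And>x. x \<in> X \<Longrightarrow> f x \<le> g x"
  shows "avg f n \<le> avg g n"
  unfolding ball_avg_def using assms ball_subset
  by (intro divide_right_mono sum_mono) auto

lemma avg_cong:
  assumes "\<And>x. x \<in> X \<Longrightarrow> f x = g x"
  shows "avg f n = avg g n"
  using assms by (intro antisym avg_mono) auto

lemma avg_const: "avg (\<lambda>x. c) n = c"
  using card_ball_pos[of n] by (simp add: ball_avg_def)

lemma avg_add: "avg (\<lambda>x. f x + g x) n = avg f n + avg g n"
  by (simp add: ball_avg_def sum.distrib add_divide_distrib)

lemma avg_diff: "avg (\<lambda>x. f x - g x) n = avg f n - avg g n"
  by (simp add: ball_avg_def sum_subtractf diff_divide_distrib)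

lemma avg_cmult: "avg (\<lambda>x. c * f x) n = c * avg f n"
  by (simp add: ball_avg_def sum_distrib_left)

lemma avg_abs_le: "\<bar>avg f n\<bar> \<le> avg (\<lambda>x. \<bar>f x\<bar>) n"
  by (simp add: ball_avg_def divide_right_mono)

lemma avg_nonneg: "(\<And>x. x \<in> X \<Longrightarrow> 0 \<le> f x) \<Longrightarrow> 0 \<le> avg f n"
  using avg_mono[of "\<lambda>x. 0" f n] by (simp add: avg_const)

lemma avg_indicator_nonneg: "0 \<le> avg (indicator A) n"
  by (simp add: avg_nonneg)

text \<open>The numerator never exceeds \<open>card K\<close>, whereas balls in an infinite graph
  grow without bound. Finite sets can thus be discarded, which links limits at infinity with
  averages.\<close>

lemma avg_indicator_finite:
  assumes "finite K"
  shows "avg (indicator K) \<longlonglongrightarrow> 0"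
proof (rule nonneg_tendsto_0_le)
  fix n
  have "(\<Sum>x\<in>gball n. indicator K x) = real (card (gball n \<inter> K))"
    using finite_ball by (simp add: indicator_def sum.If_cases Int_def)
  also have "\<dots> \<le> real (card K)"
    using assms by (simp add: card_mono)
  finally show "avg (indicator K) n \<le> real (card K) / real (card (gball n))"
    by (simp add: ball_avg_def divide_right_mono)
next
  show "(\<lambda>n. real (card K) / real (card (gball n))) \<longlonglongrightarrow> 0"
    by (intro tendsto_divide_0[OF tendsto_const] filterlim_at_top_imp_at_infinity
        filterlim_compose[OF filterlim_real_sequentially card_ball_at_top])
qed (rule avg_indicator_nonneg)

lemma avg_indicator_tendsto_0_mono:
  assumes "avg (indicator B) \<longlonglongrightarrow> 0" "A \<inter> X \<subseteq> B"
  shows "avg (indicator A) \<longlonglongrightarrow> 0"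
proof (rule nonneg_tendsto_0_le[OF assms(1)])
  show "avg (indicator A) n \<le> avg (indicator B) n" for n
    using assms(2) by (intro avg_mono) (auto simp: indicator_def)
qed (rule avg_indicator_nonneg)

lemma avg_indicator_Un:
  assumes "avg (indicator A) \<longlonglongrightarrow> 0" "avg (indicator B) \<longlonglongrightarrow> 0"
  shows "avg (indicator (A \<union> B)) \<longlonglongrightarrow> 0"
proof (rule nonneg_tendsto_0_le)
  show "avg (indicator (A \<union> B)) n \<le> avg (indicator A) n + avg (indicator B) n" for n
    unfolding avg_add[symmetric] by (intro avg_mono) (auto simp: indicator_def)
  show "(\<lambda>n. avg (indicator A) n + avg (indicator B) n) \<longlonglongrightarrow> 0"
    using tendsto_add[OF assms] by simp
qed (rule avg_indicator_nonneg)

section \<open>Convergence of averages versus convergence off sets of density zero\<close>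

lemma avg_one_minus_tendsto_0_iff: "avg (\<lambda>x. 1 - g x) \<longlonglongrightarrow> 0 \<longleftrightarrow> avg g \<longlonglongrightarrow> 1"
proof -
  have "avg (\<lambda>x. 1 - g x) = (\<lambda>n. 1 - avg g n)"
    by (simp add: avg_diff avg_const fun_eq_iff)
  then show ?thesis
    using tendsto_diff[OF tendsto_const[of 1], of "avg g" 1]
      tendsto_diff[OF tendsto_const[of 1], of "\<lambda>n. 1 - avg g n" 0]
    by auto
qed

lemma avg_indicator_compl_tendsto_0_iff:
  "avg (indicator (X - A)) \<longlonglongrightarrow> 0 \<longleftrightarrow> avg (indicator A) \<longlonglongrightarrow> 1"
proof -
  have "avg (indicator (X - A)) = avg (\<lambda>x. 1 - indicator A x)"
    by (intro ext avg_cong) (auto simp: indicator_def)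
  then show ?thesis
    by (simp add: avg_one_minus_tendsto_0_iff)
qed

text \<open>Forward by Markov's inequality. Backward, g is at most e/2 off its superlevel set of
  level e/2 and at most C on it.\<close>

lemma avg_tendsto_0_iff:
  assumes g: "\<And>x. x \<in> X \<Longrightarrow> 0 \<le> g x" "\<And>x. x \<in> X \<Longrightarrow> g x \<le> C"
  shows "avg g \<longlonglongrightarrow> 0 \<longleftrightarrow> (\<forall>e>0. avg (indicator {x\<in>X. g x \<ge> e}) \<longlonglongrightarrow> 0)"
proof safe
  fix e :: real
  assume lim: "avg g \<longlonglongrightarrow> 0" and "e > 0"
  show "avg (indicator {x\<in>X. g x \<ge> e}) \<longlonglongrightarrow> 0"
  proof (rule nonneg_tendsto_0_le)
    show "avg (indicator {x\<in>X. g x \<ge> e}) n \<le> 1 / e * avg g n" for n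
      unfolding avg_cmult[symmetric] using g \<open>e > 0\<close>
      by (intro avg_mono) (auto simp: indicator_def)
    show "(\<lambda>n. 1 / e * avg g n) \<longlonglongrightarrow> 0"
      using tendsto_mult_left[OF lim, of "1 / e"] by simp
  qed (rule avg_indicator_nonneg)
next
  assume *: "\<forall>e>0. avg (indicator {x\<in>X. g x \<ge> e}) \<longlonglongrightarrow> 0"
  show "avg g \<longlonglongrightarrow> 0"
    unfolding tendsto_iff
  proof (intro allI impI)
    fix e :: real
    assume "e > 0"
    define S where "S = {x\<in>X. g x \<ge> e / 2}"
    have "(\<lambda>n. C * avg (indicator S) n) \<longlonglongrightarrow> 0"
      unfolding S_def using * half_gt_zero[OF \<open>e > 0\<close>] by (intro tendsto_mult_right_zero) blast
    then have "eventually (\<lambda>n. C * avg (indicator S) n < e / 2) sequentially"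
      using \<open>e > 0\<close> by (intro order_tendstoD(2)) auto
    then show "eventually (\<lambda>n. dist (avg g n) 0 < e) sequentially"
    proof eventually_elim
      case (elim n)
      have "avg g n \<le> avg (\<lambda>x. e / 2 + C * indicator S x) n"
        using g \<open>e > 0\<close> by (intro avg_mono) (auto simp: indicator_def S_def add_increasing)
      also have "\<dots> = e / 2 + C * avg (indicator S) n"
        by (simp only: avg_add avg_const avg_cmult)
      finally show ?case
        using elim avg_nonneg[of g n] g(1) by simp
    qed
  qed
qed

text \<open>Deviations from \<alpha> of size at least e occur only outside A or in a finite set,
  hence on a set of density zero; being bounded, the deviation then averages to 0 in the
  limit.\<close>

lemma avg_tendsto_of_density_one:
  assumes A: "A \<subseteq> X" "avg (indicator A) \<longlonglongrightarrow> 1"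
    and lim: "(g \<longlongrightarrow> \<alpha>) (to_infinity_in X A)"
    and bound: "\<And>x. x \<in> X \<Longrightarrow> \<bar>g x\<bar> \<le> C"
  shows "avg g \<longlonglongrightarrow> \<alpha>"
proof -
  have "avg (\<lambda>x. \<bar>g x - \<alpha>\<bar>) \<longlonglongrightarrow> 0"
  proof (subst avg_tendsto_0_iff[where C = "C + \<bar>\<alpha>\<bar>"])
    show "\<forall>e>0. avg (indicator {x \<in> X. e \<le> \<bar>g x - \<alpha>\<bar>}) \<longlonglongrightarrow> 0"
    proof (intro allI impI)
      fix e :: real
      assume "e > 0"
      then have "eventually (\<lambda>x. \<bar>g x - \<alpha>\<bar> < e) (to_infinity_in X A)"
        using lim by (simp add: tendsto_iff dist_real_def)
      then obtain K where K: "finite K" "\<forall>x\<in>A - K. \<bar>g x - \<alpha>\<bar> < e"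
        using A(1) by (auto simp: eventually_to_infinity_in)
      have "avg (indicator ((X - A) \<union> K)) \<longlonglongrightarrow> 0"
        using A(2) avg_indicator_finite[OF K(1)]
        by (intro avg_indicator_Un) (simp_all add: avg_indicator_compl_tendsto_0_iff)
      then show "avg (indicator {x \<in> X. e \<le> \<bar>g x - \<alpha>\<bar>}) \<longlonglongrightarrow> 0"
        using K(2) by (rule_tac avg_indicator_tendsto_0_mono) (auto simp: not_less[symmetric])
    qed
  qed (use bound in force)+
  then have "(\<lambda>n. avg g n - \<alpha>) \<longlonglongrightarrow> 0"
  proof (rule Lim_null_comparison[rotated])
    have "\<bar>avg g n - \<alpha>\<bar> \<le> avg (\<lambda>x. \<bar>g x - \<alpha>\<bar>) n" for n
      using avg_abs_le[of "\<lambda>x. g x - \<alpha>" n] by (simp add: avg_diff avg_const)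
    then show "eventually (\<lambda>n. norm (avg g n - \<alpha>) \<le> avg (\<lambda>x. \<bar>g x - \<alpha>\<bar>) n) sequentially"
      by simp
  qed
  then show ?thesis
    by (simp add: LIM_zero_iff)
qed

text \<open>
  Write \<open>\<bar>x\<bar>\<close> for the distance from the root. With a positive decreasing majorant \<open>a n\<close> of \<open>avg g n\<close> tending to \<open>0\<close>, the exceptional set is
  \<open>B = {x. g x > sqrt (a \<bar>x\<bar>)}\<close>: Markov's inequality on the ball of radius \<open>n\<close>, where
  \<open>a \<bar>x\<bar> \<ge> a n\<close>, bounds the average of its indicator by \<open>avg g n / sqrt (a n) \<le> sqrt (a n)\<close>.
\<close>
lemma density_one_of_avg_tendsto_0:
  assumes g: "\<And>x. x \<in> X \<Longrightarrow> 0 \<le> g x" and lim: "avg g \<longlonglongrightarrow> 0"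
  obtains A where "A \<subseteq> X" "avg (indicator A) \<longlonglongrightarrow> 1" "(g \<longlongrightarrow> 0) (to_infinity_in X A)"
proof -
  \<comment> \<open>The added \<open>1 / real (Suc n)\<close> keeps b, and with it a, strictly
    positive, so that \<open>sqrt (a n)\<close> can be cancelled below; the tail suprema in a
    provide the monotonicity.\<close>
  define b where "b n = avg g n + 1 / real (Suc n)" for n
  define a where "a n = (SUP m\<in>{n..}. b m)" for n
  have b_pos: "b n > 0" for n
    using avg_nonneg[of g n] g by (simp add: b_def add_nonneg_pos)
  have b_lim: "b \<longlonglongrightarrow> 0"
    using tendsto_add[OF lim LIMSEQ_inverse_real_of_nat] by (simp add: b_def[abs_def] inverse_eq_divide)
  then have "bdd_above (range b)"
    by (intro bounded_imp_bdd_above convergent_imp_bounded)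
  then have bdd: "bdd_above (b ` {n..})" for n
    by (rule bdd_above_mono) auto
  have a_upper: "b m \<le> a n" if "n \<le> m" for m n
    unfolding a_def using that by (intro cSUP_upper bdd) auto
  have a_pos: "a n > 0" for n
    using a_upper[of n n] b_pos[of n] by simp
  have a_antimono: "a m \<le> a n" if "n \<le> m" for m n
    unfolding a_def using that by (intro cSUP_subset_mono bdd) auto
  have a_lim: "a \<longlonglongrightarrow> 0"
  proof (rule LIMSEQ_I)
    fix e :: real
    assume "e > 0"
    then obtain N where N: "\<And>n. n \<ge> N \<Longrightarrow> b n < e / 2"
      using order_tendstoD(2)[OF b_lim, of "e / 2"] by (auto simp: eventually_sequentially)
    have "a n \<le> e / 2" if "n \<ge> N" for n
      unfolding a_def using that N by (intro cSUP_least) (auto intro: less_imp_le)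
    then have "norm (a n - 0) < e" if "n \<ge> N" for n
      using that \<open>e > 0\<close> a_pos[of n] by fastforce
    then show "\<exists>N. \<forall>n\<ge>N. norm (a n - 0) < e"
      by blast
  qed
  then have sqrt_a_lim: "(\<lambda>n. sqrt (a n)) \<longlonglongrightarrow> 0"
    using tendsto_real_sqrt by fastforce
  define B where "B = {x\<in>X. g x > sqrt (a (graph_dist E r x))}"
  have "avg (indicator B) n \<le> sqrt (a n)" for n
  proof -
    have "sqrt (a n) * indicator B x \<le> g x" if "x \<in> gball n" for x
    proof -
      have "sqrt (a n) \<le> sqrt (a (graph_dist E r x))"
        using that a_antimono by (simp add: graph_ball_def)
      then show ?thesis
        using g[of x] that
        by (cases "x \<in> B") (auto simp: B_def graph_ball_def simp del: real_sqrt_le_iff)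
    qed
    then have "avg (\<lambda>x. sqrt (a n) * indicator B x) n \<le> avg g n"
      unfolding ball_avg_def by (intro divide_right_mono sum_mono) auto
    also have "\<dots> \<le> b n"
      by (simp add: b_def)
    also have "\<dots> \<le> sqrt (a n) * sqrt (a n)"
      using a_upper[of n n] a_pos[of n] by simp
    finally have "sqrt (a n) * avg (indicator B) n \<le> sqrt (a n) * sqrt (a n)"
      by (simp only: avg_cmult)
    then show ?thesis
      by (rule mult_left_le_imp_le) (simp add: a_pos)
  qed
  then have "avg (indicator B) \<longlonglongrightarrow> 0"
    by (intro nonneg_tendsto_0_le[OF sqrt_a_lim] avg_indicator_nonneg)
  moreover have "B = X - (X - B)"
    by (auto simp: B_def)
  ultimately have "avg (indicator (X - B)) \<longlonglongrightarrow> 1"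
    using avg_indicator_compl_tendsto_0_iff[of "X - B"] by simp
  moreover have "(g \<longlongrightarrow> 0) (to_infinity_in X (X - B))"
    unfolding tendsto_iff eventually_to_infinity_in[OF Diff_subset]
  proof (intro allI impI)
    fix e :: real
    assume "e > 0"
    then obtain N where N: "\<And>n. n \<ge> N \<Longrightarrow> sqrt (a n) < e"
      using order_tendstoD(2)[OF sqrt_a_lim, of e] by (auto simp: eventually_sequentially)
    \<comment> \<open>The ball of radius N is the finite set to remove: beyond it the threshold at
      the distance of x is already below e.\<close>
    have "dist (g x) 0 < e" if x: "x \<in> X - B - gball N" for x
    proof -
      have "g x \<le> sqrt (a (graph_dist E r x))" "sqrt (a (graph_dist E r x)) < e"
        using x by (auto simp: B_def graph_ball_def intro!: N)
      then show ?thesis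
        using g[of x] x by simp
    qed
    then show "\<exists>K. finite K \<and> (\<forall>x\<in>X - B - K. dist (g x) 0 < e)"
      using finite_ball by blast
  qed
  ultimately show ?thesis
    using that[of "X - B"] by auto
qed

section \<open>Existence of limits, measurability and lower and upper limits in terms of
  averages\<close>

lemma L_exists_avg_iff: "L_exists X E r g \<and> L_avg X E r g = c \<longleftrightarrow> avg g \<longlonglongrightarrow> c"
  unfolding L_exists_def L_avg_def using convergent_LIMSEQ_iff convergentI limI by blast

lemma L_set_eq_1_iff:
  "L_measurable X E r A \<and> L_set X E r A = 1 \<longleftrightarrow> A \<subseteq> X \<and> avg (indicator A) \<longlonglongrightarrow> 1"
  unfolding L_measurable_def L_set_def using L_exists_avg_iff by blast

lemma infL_eq_of_tendsto: "avg g \<longlonglongrightarrow> c \<Longrightarrow> infL X E r g = ereal c"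
  unfolding infL_def by (intro lim_imp_Liminf) auto

lemma infL_le_1:
  assumes "\<And>x. x \<in> X \<Longrightarrow> g x \<le> 1"
  shows "infL X E r g \<le> 1"
proof -
  have "avg g n \<le> 1" for n
    using avg_mono[of g "\<lambda>x. 1" n] assms by (simp add: avg_const)
  then have "limsup (\<lambda>n. ereal (avg g n)) \<le> 1"
    by (intro Limsup_bounded) (simp add: one_ereal_def)
  then show ?thesis
    unfolding infL_def using Liminf_le_Limsup[of sequentially "\<lambda>n. ereal (avg g n)"] by simp
qed

text \<open>Averages are at most 1, so a lower limit equal to 1 meets the upper limit.\<close>

lemma infL_eq_1_iff:
  assumes "\<And>x. x \<in> X \<Longrightarrow> g x \<le> 1"
  shows "infL X E r g = 1 \<longleftrightarrow> avg g \<longlonglongrightarrow> 1"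
proof
  assume "infL X E r g = 1"
  then have "liminf (\<lambda>n. ereal (avg g n)) = 1"
    by (simp add: infL_def)
  moreover have "avg g n \<le> 1" for n
    using avg_mono[of g "\<lambda>x. 1" n] assms by (simp add: avg_const)
  then have "limsup (\<lambda>n. ereal (avg g n)) \<le> 1"
    by (intro Limsup_bounded) (simp add: one_ereal_def)
  ultimately have "(\<lambda>n. ereal (avg g n)) \<longlonglongrightarrow> 1"
    using Liminf_le_Limsup[of sequentially "\<lambda>n. ereal (avg g n)"]
    by (intro Liminf_eq_Limsup) auto
  then show "avg g \<longlonglongrightarrow> 1"
    by (simp add: one_ereal_def)
next
  assume "avg g \<longlonglongrightarrow> 1"
  then show "infL X E r g = 1"
    using infL_eq_of_tendsto by (simp add: one_ereal_def)
qed

text \<open>Averages of an indicator are nonnegative, so an upper limit that is not positive forces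
  convergence to 0.\<close>

lemma supL_set_pos_iff: "supL_set X E r A > 0 \<longleftrightarrow> \<not> avg (indicator A) \<longlonglongrightarrow> 0"
proof
  assume "supL_set X E r A > 0"
  moreover have "supL_set X E r A = 0" if "avg (indicator A) \<longlonglongrightarrow> 0"
    unfolding supL_set_def supL_def using that
    by (intro lim_imp_Limsup) (auto simp: zero_ereal_def)
  ultimately show "\<not> avg (indicator A) \<longlonglongrightarrow> 0"
    by auto
next
  assume not_lim: "\<not> avg (indicator A) \<longlonglongrightarrow> 0"
  show "supL_set X E r A > 0"
  proof (rule ccontr)
    assume "\<not> supL_set X E r A > 0"
    then have "limsup (\<lambda>n. ereal (avg (indicator A) n)) \<le> 0"
      by (simp add: supL_set_def supL_def)
    moreover have "liminf (\<lambda>n. ereal (avg (indicator A) n)) \<ge> 0"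
      by (intro Liminf_bounded) (auto simp: avg_indicator_nonneg)
    ultimately have "(\<lambda>n. ereal (avg (indicator A) n)) \<longlonglongrightarrow> 0"
      using Liminf_le_Limsup[of sequentially "\<lambda>n. ereal (avg (indicator A) n)"]
      by (intro Liminf_eq_Limsup) auto
    with not_lim show False
      by (simp add: zero_ereal_def)
  qed
qed

lemma avg_tendsto_1_iff:
  assumes "\<And>x. x \<in> X \<Longrightarrow> 0 \<le> g x" "\<And>x. x \<in> X \<Longrightarrow> g x \<le> 1"
  shows "avg g \<longlonglongrightarrow> 1 \<longleftrightarrow> (\<forall>e>0. avg (indicator {x\<in>X. g x \<le> 1 - e}) \<longlonglongrightarrow> 0)"
proof -
  have "avg g \<longlonglongrightarrow> 1 \<longleftrightarrow> avg (\<lambda>x. 1 - g x) \<longlonglongrightarrow> 0"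
    by (rule avg_one_minus_tendsto_0_iff[symmetric])
  also have "\<dots> \<longleftrightarrow> (\<forall>e>0. avg (indicator {x\<in>X. e \<le> 1 - g x}) \<longlonglongrightarrow> 0)"
    using assms by (intro avg_tendsto_0_iff[where C = 1]) auto
  also have "\<dots> \<longleftrightarrow> (\<forall>e>0. avg (indicator {x\<in>X. g x \<le> 1 - e}) \<longlonglongrightarrow> 0)"
    by (simp add: algebra_simps)
  finally show ?thesis .
qed

end

section \<open>The classification\<close>

theorem proposition3p5:
  fixes X :: "'a set" and E :: "('a \<times> 'a) set" and r :: 'a and P :: "'a \<Rightarrow> 'a pmf"
  assumes "nonoriented_graph X E" and "infinite X" and "graph_connected X E"
    and "locally_finite_graph X E" and "r \<in> X" and "random_walk_on X P"
  shows "(\<forall>\<alpha>::real. (\<exists>A. L_measurable X E r A \<and> L_set X E r A = 1 \<and>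
              (return_prob P \<longlongrightarrow> \<alpha>) (to_infinity_in X A)) \<longrightarrow>
          L_exists X E r (return_prob P) \<and> L_avg X E r (return_prob P) = \<alpha> \<and>
          (TOA X E r P \<longleftrightarrow> \<alpha> < 1) \<and> (ROA X E r P \<longleftrightarrow> \<alpha> = 1)) \<and>
    (locally_recurrent X P \<longrightarrow>
          L_exists X E r (return_prob P) \<and> L_avg X E r (return_prob P) = 1 \<and> ROA X E r P) \<and>
    (thermo_ROA X E r P \<longrightarrow>
          L_exists X E r (return_prob P) \<and> L_avg X E r (return_prob P) = 1 \<and> ROA X E r P) \<and>
    (totally_convergent X P \<and> thermo_TOA X E r P \<longrightarrow>
          L_exists X E r (return_prob P) \<and> L_avg X E r (return_prob P) < 1 \<and> TOA X E r P) \<and>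
    (ROA X E r P \<longleftrightarrow>
          (\<forall>\<epsilon>>0. L_measurable X E r {x \<in> X. return_prob P x \<ge> 1 - \<epsilon>} \<and>
                 L_set X E r {x \<in> X. return_prob P x \<ge> 1 - \<epsilon>} = 1)) \<and>
    (ROA X E r P \<longleftrightarrow>
          (\<exists>A. L_measurable X E r A \<and> L_set X E r A = 1 \<and>
               (return_prob P \<longlongrightarrow> 1) (to_infinity_in X A))) \<and>
    (TOA X E r P \<longleftrightarrow>
          (\<exists>A\<subseteq>X. supL_set X E r A > 0 \<and> (SUP x\<in>A. return_prob P x) < 1))"
proof -
  interpret ball_averages X E r
    using assms by unfold_locales
  let ?F = "return_prob P"
  note F = return_prob_nonneg[of P] return_prob_le_1[of P]
  have F_abs: "\<bar>?F x\<bar> \<le> 1" for x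
    using F[of x] by simp
  have ROA_iff: "ROA X E r P \<longleftrightarrow> avg ?F \<longlonglongrightarrow> 1"
    unfolding ROA_def by (rule infL_eq_1_iff) (rule F)
  \<comment> \<open>As F is at most 1, so is its lower average; being below 1 is then the negation
    of being equal to 1.\<close>
  have TOA_iff: "TOA X E r P \<longleftrightarrow> \<not> ROA X E r P"
    using infL_le_1[of ?F] F(2) unfolding TOA_def ROA_def by (auto simp: order_less_le)

  have i: "L_exists X E r ?F \<and> L_avg X E r ?F = \<alpha> \<and>
      (TOA X E r P \<longleftrightarrow> \<alpha> < 1) \<and> (ROA X E r P \<longleftrightarrow> \<alpha> = 1)"
    if "L_measurable X E r A \<and> L_set X E r A = 1 \<and> (?F \<longlongrightarrow> \<alpha>) (to_infinity_in X A)" for \<alpha> A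
  proof -
    have "A \<subseteq> X" "avg (indicator A) \<longlonglongrightarrow> 1" "(?F \<longlongrightarrow> \<alpha>) (to_infinity_in X A)"
      using that L_set_eq_1_iff by blast+
    then have lim: "avg ?F \<longlonglongrightarrow> \<alpha>"
      using F_abs by (rule avg_tendsto_of_density_one)
    then have "L_exists X E r ?F \<and> L_avg X E r ?F = \<alpha>"
      by (simp only: L_exists_avg_iff)
    moreover have "infL X E r ?F = ereal \<alpha>"
      by (rule infL_eq_of_tendsto[OF lim])
    ultimately show ?thesis
      by (simp add: TOA_def ROA_def one_ereal_def)
  qed

  have ROA_lim: "L_exists X E r ?F \<and> L_avg X E r ?F = 1 \<and> ROA X E r P" if "avg ?F \<longlonglongrightarrow> 1"
    using that L_exists_avg_iff ROA_iff by blast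

  have ii: "L_exists X E r ?F \<and> L_avg X E r ?F = 1 \<and> ROA X E r P" if "locally_recurrent X P"
  proof (rule ROA_lim)
    have "avg ?F = (\<lambda>_. 1)"
      using avg_cong[of ?F "\<lambda>_. 1"] locally_recurrent_return_prob[OF that]
      by (simp add: avg_const fun_eq_iff)
    then show "avg ?F \<longlonglongrightarrow> 1"
      by simp
  qed

  \<comment> \<open>The value of \<open>L_avg\<close> has meaning only when the limit exists, so z
    is confined to an interval below 1 where it does.\<close>
  have avg_gf: "eventually (\<lambda>z. 0 < z \<and> z < 1 \<and>
      avg (return_gf P z) \<longlonglongrightarrow> L_avg X E r (return_gf P z)) (at_left 1)"
    if near: "L_exists_near_1 X E r P"
  proof -
    obtain \<epsilon> where \<epsilon>: "\<epsilon> \<in> {0<..<1}" "\<forall>z\<in>{\<epsilon><..<1}. L_exists X E r (return_gf P z)"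
      using near by (auto simp: L_exists_near_1_def)
    show ?thesis
    proof (rule eventually_at_leftI)
      show "0 < z \<and> z < 1 \<and> avg (return_gf P z) \<longlonglongrightarrow> L_avg X E r (return_gf P z)"
        if "z \<in> {\<epsilon><..<1}" for z
        using that \<epsilon> L_exists_avg_iff[of "return_gf P z"] by auto
    qed (use \<epsilon> in auto)
  qed

  have iii: "L_exists X E r ?F \<and> L_avg X E r ?F = 1 \<and> ROA X E r P" if thermo: "thermo_ROA X E r P"
  proof (rule ROA_lim, rule order_tendstoI)
    fix a :: real
    assume "a < 1"
    have near: "L_exists_near_1 X E r P"
      and lim: "((\<lambda>z. L_avg X E r (return_gf P z)) \<longlongrightarrow> 1) (at_left 1)"
      using thermo by (simp_all add: thermo_ROA_def)
    \<comment> \<open>One z close to 1 suffices: the averages of F(x,x|z) eventually exceed a and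
      are dominated by those of F.\<close>
    have "eventually (\<lambda>z. L_avg X E r (return_gf P z) > a \<and> 0 < z \<and> z < 1 \<and>
        avg (return_gf P z) \<longlonglongrightarrow> L_avg X E r (return_gf P z)) (at_left 1)"
      by (rule eventually_conj[OF order_tendstoD(1)[OF lim \<open>a < 1\<close>] avg_gf[OF near]])
    then obtain z where z: "L_avg X E r (return_gf P z) > a" "0 < z" "z < 1"
        "avg (return_gf P z) \<longlonglongrightarrow> L_avg X E r (return_gf P z)"
      using eventually_happens'[OF trivial_limit_at_left_real] by blast
    show "eventually (\<lambda>n. avg ?F n > a) sequentially"
      using order_tendstoD(1)[OF z(4,1)]
    proof eventually_elim
      case (elim n)
      also have "avg (return_gf P z) n \<le> avg ?F n"
        using z by (intro avg_mono return_gf_le_return_prob) auto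
      finally show ?case .
    qed
  next
    fix a :: real
    assume "1 < a"
    have "avg ?F n \<le> 1" for n
      using avg_mono[of ?F "\<lambda>_. 1" n] F(2) by (simp add: avg_const)
    then show "eventually (\<lambda>n. avg ?F n < a) sequentially"
      using \<open>1 < a\<close> by (intro always_eventually allI) (rule le_less_trans)
  qed

  have iv: "L_exists X E r ?F \<and> L_avg X E r ?F < 1 \<and> TOA X E r P"
    if total: "totally_convergent X P" and thermo: "thermo_TOA X E r P"
  proof -
    obtain l where l: "l < 1" "((\<lambda>z. L_avg X E r (return_gf P z)) \<longlongrightarrow> l) (at_left 1)"
      and near: "L_exists_near_1 X E r P"
      using thermo by (auto simp: thermo_TOA_def)
    have lim: "avg ?F \<longlonglongrightarrow> l"
      unfolding tendsto_iff
    proof (intro allI impI)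
      fix e :: real
      assume "e > 0"
      \<comment> \<open>A three-epsilon argument with a single z: as the first estimate is uniform
        in x, it passes to the averages over all balls at once.\<close>
      have "eventually (\<lambda>z. (\<forall>x\<in>X. \<bar>return_gf P z x - ?F x\<bar> < e / 3) \<and>
          dist (L_avg X E r (return_gf P z)) l < e / 3 \<and>
          avg (return_gf P z) \<longlonglongrightarrow> L_avg X E r (return_gf P z)) (at_left 1)"
        using \<open>e > 0\<close>
        by (intro eventually_conj totally_convergent_uniform[OF total] tendstoD[OF l(2)]
            eventually_mono[OF avg_gf[OF near]]) auto
      then obtain z where z: "\<forall>x\<in>X. \<bar>return_gf P z x - ?F x\<bar> < e / 3"
          "dist (L_avg X E r (return_gf P z)) l < e / 3"
          "avg (return_gf P z) \<longlonglongrightarrow> L_avg X E r (return_gf P z)"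
        using eventually_happens'[OF trivial_limit_at_left_real] by blast
      have "eventually (\<lambda>n. dist (avg (return_gf P z) n) (L_avg X E r (return_gf P z)) < e / 3) sequentially"
        using z(3) \<open>e > 0\<close> by (intro tendstoD) auto
      then show "eventually (\<lambda>n. dist (avg ?F n) l < e) sequentially"
      proof eventually_elim
        case (elim n)
        have "\<bar>avg (return_gf P z) n - avg ?F n\<bar> \<le> avg (\<lambda>x. \<bar>return_gf P z x - ?F x\<bar>) n"
          using avg_abs_le[of "\<lambda>x. return_gf P z x - ?F x" n] by (simp only: avg_diff)
        also have "\<dots> \<le> avg (\<lambda>_. e / 3) n"
          using z(1) by (intro avg_mono) (auto intro: less_imp_le)
        finally show ?case
          using elim z(2) unfolding avg_const dist_real_def by linarith
      qed
    qed
    moreover have "infL X E r ?F = ereal l"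
      by (rule infL_eq_of_tendsto[OF lim])
    ultimately show ?thesis
      using L_exists_avg_iff[of ?F l] l(1) by (auto simp: TOA_def one_ereal_def)
  qed

  \<comment> \<open>Characterisations by sets of full or positive density\<close>
  have ROA_iff_sublevel: "ROA X E r P \<longleftrightarrow>
      (\<forall>\<epsilon>>0. avg (indicator {x\<in>X. ?F x \<le> 1 - \<epsilon>}) \<longlonglongrightarrow> 0)"
    unfolding ROA_iff using F by (rule avg_tendsto_1_iff)

  have v: "ROA X E r P \<longleftrightarrow> (\<forall>\<epsilon>>0. L_measurable X E r {x\<in>X. ?F x \<ge> 1 - \<epsilon>} \<and>
      L_set X E r {x\<in>X. ?F x \<ge> 1 - \<epsilon>} = 1)"
  proof -
    have "ROA X E r P \<longleftrightarrow> (\<forall>\<epsilon>>0. avg (indicator (X - {x\<in>X. ?F x \<ge> 1 - \<epsilon>})) \<longlonglongrightarrow> 0)"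
      unfolding ROA_iff_sublevel
    proof (intro iffI allI impI)
      fix \<epsilon> :: real
      assume *: "\<forall>\<epsilon>>0. avg (indicator {x\<in>X. ?F x \<le> 1 - \<epsilon>}) \<longlonglongrightarrow> 0" and "\<epsilon> > 0"
      then have "avg (indicator {x\<in>X. ?F x \<le> 1 - \<epsilon>}) \<longlonglongrightarrow> 0"
        by blast
      then show "avg (indicator (X - {x\<in>X. ?F x \<ge> 1 - \<epsilon>})) \<longlonglongrightarrow> 0"
        by (rule avg_indicator_tendsto_0_mono) auto
    next
      fix \<epsilon> :: real
      assume *: "\<forall>\<epsilon>>0. avg (indicator (X - {x\<in>X. ?F x \<ge> 1 - \<epsilon>})) \<longlonglongrightarrow> 0" and "\<epsilon> > 0"
      \<comment> \<open>The complement of a superlevel set is a strict sublevel set; halving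
        \<epsilon> leaves room for the non-strict one.\<close>
      then have "avg (indicator (X - {x\<in>X. ?F x \<ge> 1 - \<epsilon> / 2})) \<longlonglongrightarrow> 0"
        by (meson half_gt_zero)
      then show "avg (indicator {x\<in>X. ?F x \<le> 1 - \<epsilon>}) \<longlonglongrightarrow> 0"
        by (rule avg_indicator_tendsto_0_mono) (use \<open>\<epsilon> > 0\<close> in auto)
    qed
    then show ?thesis
      unfolding L_set_eq_1_iff avg_indicator_compl_tendsto_0_iff by auto
  qed

  have vi: "ROA X E r P \<longleftrightarrow> (\<exists>A. L_measurable X E r A \<and> L_set X E r A = 1 \<and>
      (?F \<longlongrightarrow> 1) (to_infinity_in X A))"
  proof
    assume "ROA X E r P"
    then have "avg (\<lambda>x. 1 - ?F x) \<longlonglongrightarrow> 0"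
      by (simp add: ROA_iff avg_one_minus_tendsto_0_iff)
    \<comment> \<open>The construction with the slowly decreasing threshold is applied to the defect
      \<open>1 - ?F x\<close>.\<close>
    then obtain A where A: "A \<subseteq> X" "avg (indicator A) \<longlonglongrightarrow> 1"
        "((\<lambda>x. 1 - ?F x) \<longlongrightarrow> 0) (to_infinity_in X A)"
      using F(2) by (auto elim: density_one_of_avg_tendsto_0[rotated])
    have "(?F \<longlongrightarrow> 1) (to_infinity_in X A)"
      using tendsto_diff[OF tendsto_const[of 1] A(3)] by simp
    then show "\<exists>A. L_measurable X E r A \<and> L_set X E r A = 1 \<and> (?F \<longlongrightarrow> 1) (to_infinity_in X A)"
      using A(1,2) L_set_eq_1_iff by blast
  qed (use i in blast)

  have vii: "TOA X E r P \<longleftrightarrow> (\<exists>A\<subseteq>X. supL_set X E r A > 0 \<and> (SUP x\<in>A. ?F x) < 1)"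
  proof
    assume "TOA X E r P"
    then obtain \<epsilon> where \<epsilon>: "\<epsilon> > 0" "\<not> avg (indicator {x\<in>X. ?F x \<le> 1 - \<epsilon>}) \<longlonglongrightarrow> 0"
      unfolding TOA_iff ROA_iff_sublevel by blast
    define A where "A = {x\<in>X. ?F x \<le> 1 - \<epsilon>}"
    have pos: "supL_set X E r A > 0"
      using \<epsilon>(2) by (simp add: supL_set_pos_iff A_def)
    \<comment> \<open>Over the reals an upper bound controls the supremum only of a nonempty set;
      the empty set is excluded because its averages tend to 0.\<close>
    then have "A \<noteq> {}"
      using avg_indicator_finite[of "{}"] by (auto simp: supL_set_pos_iff)
    then have "(SUP x\<in>A. ?F x) \<le> 1 - \<epsilon>"
      by (rule cSUP_least) (simp add: A_def)
    then show "\<exists>A\<subseteq>X. supL_set X E r A > 0 \<and> (SUP x\<in>A. ?F x) < 1"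
      using pos \<epsilon>(1) by (intro exI[of _ A]) (auto simp: A_def)
  next
    assume "\<exists>A\<subseteq>X. supL_set X E r A > 0 \<and> (SUP x\<in>A. ?F x) < 1"
    then obtain A where A: "A \<subseteq> X" "supL_set X E r A > 0" "(SUP x\<in>A. ?F x) < 1"
      by blast
    \<comment> \<open>The gap \<open>1 - s\<close> is positive and serves as the \<epsilon> at which
      the sublevel criterion for ROA fails.\<close>
    define s where "s = (SUP x\<in>A. ?F x)"
    have "?F x \<le> s" if "x \<in> A" for x
      unfolding s_def using that F(2) by (intro cSUP_upper bdd_aboveI[where M = 1]) auto
    then have "A \<inter> X \<subseteq> {x\<in>X. ?F x \<le> 1 - (1 - s)}"
      by auto
    then have "\<not> avg (indicator {x\<in>X. ?F x \<le> 1 - (1 - s)}) \<longlonglongrightarrow> 0"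
      using A(2) avg_indicator_tendsto_0_mono unfolding supL_set_pos_iff by blast
    then show "TOA X E r P"
      unfolding TOA_iff ROA_iff_sublevel using A(3) by (auto simp: s_def intro!: exI[of _ "1 - s"])
  qed

  show ?thesis
    using i ii iii iv v vi vii by blast
qed

end
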